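(* Let $\lambda,\mu,\nu$ be polynomial dominant weights of $GL_n$ with $\mu_i\le\lambda_i$ for all $i$. For $Y\in LR(\lambda/\mu,\nu)$, let $Y^c$ be its companion tableau and let $T_{Y^c}=(t^{(i)}_j)_{1\le j\le i\le n}$ be the $t$-array with $t^{(i)}_j=\sum_{k=1}^i a_{k,j}(Y^c)$ (equivalently, $t^{(i)}_j$ is the number of entries equal to $j$ in rows $1,\dots,i$ of $Y$). Then $\psi(Y)=T_{Y^c}$ defines a bijection from $LR(\lambda/\mu,\nu)$ onto $GZ(\nu,\lambda-\mu,\mu)$.
   Context: A polynomial dominant weight of $GL_n$ is a sequence of nonnegative integers $\lambda=(\lambda_1,\dots,\lambda_n)$ with $\lambda_1\ge\dots\ge\lambda_n$; differences are componentwise. Tableaux are drawn in English convention; row $r$ of the skew shape $\lambda/\mu$ consists of the boxes in columns $\mu_r+1,\dots,\lambda_r$. A tableau on $\lambda/\mu$ (filling with positive integers) is an LR tableau if (1) it is semistandard: entries weakly increase along rows from left to right and strictly increase down columns; and (2) its reverse reading word is Yamanouchi: if $x_1\cdots x_r$ is the word obtained by reading entries left to right in each row, starting from the bottom row and going up, then for every $s$ the word $x_rx_{r-1}\cdots x_s$ contains at least as many $a$'s as $(a+1)$'s for every $a\ge1$. Its content is $\nu$ if entry $k$ appears $\nu_k$ times for each $k$. $LR(\lambda/\mu,\nu)$ is the set of LR tableaux of shape $\lambda/\mu$ with content $\nu$. For a tableau $Y$, $a_{i,j}(Y)$ is the number of entries equal to $i$ in the $j$-th row of $Y$. The companion tableau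 $Y^c$ of $Y$ is the (non-skew) tableau whose rows weakly increase and whose $j$-th row contains exactly $a_{i,j}(Y^c)=a_{j,i}(Y)$ entries equal to $i$, for $1\le i,j\le n$. A $t$-array is an integer array $T=(t^{(i)}_j)_{1\le j\le i\le n}$; its type is its $n$-th row; its weight is $(w_1,\dots,w_n)$ with $w_1=t^{(1)}_1$, $w_i=\sum_{k=1}^i t^{(i)}_k-\sum_{k=1}^{i-1}t^{(i-1)}_k$ for $i\ge2$. $T$ is a GT pattern if $t^{(i+1)}_j\ge t^{(i)}_j$ and $t^{(i)}_j\ge t^{(i+1)}_{j+1}$ for all $1\le j\le i\le n-1$. Its exponents are $\varepsilon^{(i)}_j(T)=\sum_{1\le h<j}(t^{(i+1)}_h-2t^{(i)}_h+t^{(i-1)}_h)+(t^{(i+1)}_j-t^{(i)}_j)$ for $1\le j\le i\le n-1$. For weakly decreasing $\alpha,\gamma\in\mathbb{Z}^n$ and $\beta\in\mathbb{Z}^n$, $GZ(\alpha,\beta,\gamma)$ is the set of GT patterns of type $\alpha$ and weight $\beta$ with $\varepsilon^{(i)}_j(T)\le\gamma_i-\gamma_{i+1}$ for all $1\le j\le i\le n-1$. *)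

theory Defs
  imports "HOL-Library.Multiset"
begin

text \<open>
  A weight \<open>\<lambda>\<close> of \<open>GL\<^sub>n\<close> is a function on \<^typ>\<open>nat\<close> of which only the values at
  \<open>1, \<dots>, n\<close> matter.  Rows and columns of tableaux are numbered from \<open>1\<close>.
\<close>

definition polynomial_dominant_weight :: "nat \<Rightarrow> (nat \<Rightarrow> nat) \<Rightarrow> bool" where
  "polynomial_dominant_weight n lam \<longleftrightarrow> antimono_on {1..n} lam"

definition skew_shape :: "nat \<Rightarrow> (nat \<Rightarrow> nat) \<Rightarrow> (nat \<Rightarrow> nat) \<Rightarrow> (nat \<times> nat) set" where
  "skew_shape n lam mu = {(r, c). r \<in> {1..n} \<and> c \<in> {mu r + 1..lam r}}"

text \<open>
  \<open>Y r c\<close> is the entry of \<open>Y\<close> in row \<open>r\<close> and column \<open>c\<close>; the value \<open>0\<close>, which is not a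
  legal entry, means that there is no box at this place.
\<close>

type_synonym tableau = "nat \<Rightarrow> nat \<Rightarrow> nat"

definition tableaux :: "nat \<Rightarrow> (nat \<Rightarrow> nat) \<Rightarrow> (nat \<Rightarrow> nat) \<Rightarrow> tableau set" where
  "tableaux n lam mu =
    {Y. \<forall>r c. if (r, c) \<in> skew_shape n lam mu then 1 \<le> Y r c else Y r c = 0}"

definition rows_weakly_increasing ::
    "nat \<Rightarrow> (nat \<Rightarrow> nat) \<Rightarrow> (nat \<Rightarrow> nat) \<Rightarrow> tableau \<Rightarrow> bool" where
  "rows_weakly_increasing n lam mu Y \<longleftrightarrow>
    (\<forall>r c c'. (r, c) \<in> skew_shape n lam mu \<and> (r, c') \<in> skew_shape n lam mu \<and> c \<le> c'
       \<longrightarrow> Y r c \<le> Y r c')"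

definition columns_strictly_increasing ::
    "nat \<Rightarrow> (nat \<Rightarrow> nat) \<Rightarrow> (nat \<Rightarrow> nat) \<Rightarrow> tableau \<Rightarrow> bool" where
  "columns_strictly_increasing n lam mu Y \<longleftrightarrow>
    (\<forall>r r' c. (r, c) \<in> skew_shape n lam mu \<and> (r', c) \<in> skew_shape n lam mu \<and> r < r'
       \<longrightarrow> Y r c < Y r' c)"

definition semistandard ::
    "nat \<Rightarrow> (nat \<Rightarrow> nat) \<Rightarrow> (nat \<Rightarrow> nat) \<Rightarrow> tableau \<Rightarrow> bool" where
  "semistandard n lam mu Y \<longleftrightarrow>
    rows_weakly_increasing n lam mu Y \<and> columns_strictly_increasing n lam mu Y"

definition reading_word ::
    "nat \<Rightarrow> (nat \<Rightarrow> nat) \<Rightarrow> (nat \<Rightarrow> nat) \<Rightarrow> tableau \<Rightarrow> nat list" where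
  "reading_word n lam mu Y =
    concat (map (\<lambda>r. map (Y r) [mu r + 1..<lam r + 1]) (rev [1..<n + 1]))"

text \<open>
  The reverse of a word \<open>x\<^sub>1 \<dots> x\<^sub>r\<close> is Yamanouchi; the words \<open>x\<^sub>r x\<^sub>r\<^sub>-\<^sub>1 \<dots> x\<^sub>s\<close> are the initial
  segments of that reverse.
\<close>

definition yamanouchi :: "nat list \<Rightarrow> bool" where
  "yamanouchi w \<longleftrightarrow>
    (\<forall>m a. 1 \<le> a \<longrightarrow> count_list (take m w) (a + 1) \<le> count_list (take m w) a)"

definition has_content ::
    "nat \<Rightarrow> (nat \<Rightarrow> nat) \<Rightarrow> (nat \<Rightarrow> nat) \<Rightarrow> (nat \<Rightarrow> nat) \<Rightarrow> tableau \<Rightarrow> bool" where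
  "has_content n lam mu nu Y \<longleftrightarrow>
    (\<forall>k\<ge>1. card {(r, c) \<in> skew_shape n lam mu. Y r c = k} = (if k \<le> n then nu k else 0))"

definition LR :: "nat \<Rightarrow> (nat \<Rightarrow> nat) \<Rightarrow> (nat \<Rightarrow> nat) \<Rightarrow> (nat \<Rightarrow> nat) \<Rightarrow> tableau set" where
  "LR n lam mu nu =
    {Y \<in> tableaux n lam mu. semistandard n lam mu Y
       \<and> yamanouchi (rev (reading_word n lam mu Y)) \<and> has_content n lam mu nu Y}"

text \<open>\<open>entry_count Y i j\<close> is \<open>a\<^sub>i\<^sub>,\<^sub>j(Y)\<close>; it is meaningful for \<open>i \<ge> 1\<close> only.\<close>

definition entry_count :: "tableau \<Rightarrow> nat \<Rightarrow> nat \<Rightarrow> nat" where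
  "entry_count Y i j = card {c. Y j c = i}"

definition companion_row :: "nat \<Rightarrow> tableau \<Rightarrow> nat \<Rightarrow> nat list" where
  "companion_row n Y j = concat (map (\<lambda>i. replicate (entry_count Y j i) i) [1..<n + 1])"

definition companion :: "nat \<Rightarrow> tableau \<Rightarrow> tableau" where
  "companion n Y = (\<lambda>j c. if j \<in> {1..n} \<and> c \<in> {1..length (companion_row n Y j)}
     then companion_row n Y j ! (c - 1) else 0)"

text \<open>\<open>T i j\<close> is \<open>t\<^sup>(\<^sup>i\<^sup>)\<^sub>j\<close>; it is \<open>0\<close> outside the triangle \<open>1 \<le> j \<le> i \<le> n\<close>.\<close>

definition t_arrays :: "nat \<Rightarrow> (nat \<Rightarrow> nat \<Rightarrow> int) set" where
  "t_arrays n = {T. \<forall>i j. \<not> (1 \<le> j \<and> j \<le> i \<and> i \<le> n) \<longrightarrow> T i j = 0}"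

definition has_type :: "nat \<Rightarrow> (nat \<Rightarrow> nat \<Rightarrow> int) \<Rightarrow> (nat \<Rightarrow> int) \<Rightarrow> bool" where
  "has_type n T \<alpha> \<longleftrightarrow> (\<forall>j\<in>{1..n}. T n j = \<alpha> j)"

definition weight :: "(nat \<Rightarrow> nat \<Rightarrow> int) \<Rightarrow> nat \<Rightarrow> int" where
  "weight T i = (if i = 1 then T 1 1 else (\<Sum>k=1..i. T i k) - (\<Sum>k=1..i - 1. T (i - 1) k))"

definition GT_pattern :: "nat \<Rightarrow> (nat \<Rightarrow> nat \<Rightarrow> int) \<Rightarrow> bool" where
  "GT_pattern n T \<longleftrightarrow>
    (\<forall>i j. 1 \<le> j \<and> j \<le> i \<and> i < n \<longrightarrow> T i j \<le> T (i + 1) j \<and> T (i + 1) (j + 1) \<le> T i j)"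

definition exponent :: "(nat \<Rightarrow> nat \<Rightarrow> int) \<Rightarrow> nat \<Rightarrow> nat \<Rightarrow> int" where
  "exponent T i j =
    (\<Sum>h\<in>{1..<j}. T (i + 1) h - 2 * T i h + T (i - 1) h) + (T (i + 1) j - T i j)"

definition GZ :: "nat \<Rightarrow> (nat \<Rightarrow> int) \<Rightarrow> (nat \<Rightarrow> int) \<Rightarrow> (nat \<Rightarrow> int) \<Rightarrow> (nat \<Rightarrow> nat \<Rightarrow> int) set" where
  "GZ n \<alpha> \<beta> \<gamma> =
    {T \<in> t_arrays n. GT_pattern n T \<and> has_type n T \<alpha> \<and> (\<forall>i\<in>{1..n}. weight T i = \<beta> i)
       \<and> (\<forall>i j. 1 \<le> j \<and> j \<le> i \<and> i < n \<longrightarrow> exponent T i j \<le> \<gamma> i - \<gamma> (i + 1))}"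

definition array_of_tableau :: "nat \<Rightarrow> tableau \<Rightarrow> nat \<Rightarrow> nat \<Rightarrow> int" where
  "array_of_tableau n Z =
    (\<lambda>i j. if 1 \<le> j \<and> j \<le> i \<and> i \<le> n then (\<Sum>k=1..i. int (entry_count Z k j)) else 0)"

definition \<psi> :: "nat \<Rightarrow> tableau \<Rightarrow> nat \<Rightarrow> nat \<Rightarrow> int" where
  "\<psi> n Y = array_of_tableau n (companion n Y)"


lemma count_list_map_upt: "count_list (map f [a..<b]) x = card {c \<in> {a..<b}. f c = x}"
proof -
  have "count_list (map f [a..<b]) x = length (filter (\<lambda>c. f c = x) [a..<b])"
    by (induction b) auto
  also have "\<dots> = card (set (filter (\<lambda>c. f c = x) [a..<b]))"
    by (subst distinct_card) auto
  also have "set (filter (\<lambda>c. f c = x) [a..<b]) = {c \<in> {a..<b}. f c = x}" by auto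
  finally show ?thesis .
qed

lemma length_companion_row: "length (companion_row n Y j) = (\<Sum>i=1..n. entry_count Y j i)"
  by (induction n) (auto simp: companion_row_def)

lemma sorted_companion_row: "sorted (companion_row n Y j)"
  by (induction n) (auto simp: companion_row_def sorted_append)

lemma count_list_companion_row:
  "count_list (companion_row n Y j) i = (if i \<in> {1..n} then entry_count Y j i else 0)"
proof -
  have r: "count_list (replicate m x) i = (if x = i then m else 0)" for m x
    by (induction m) auto
  show ?thesis by (induction n) (auto simp: companion_row_def r)
qed

lemma entry_count_tableau:
  assumes "Z \<in> tableaux n len (\<lambda>_. 0)" "j \<in> {1..n}" "i \<ge> 1"
  shows "entry_count Z i j = count_list (map (Z j) [1..<len j + 1]) i"
proof -
  have "{c. Z j c = i} = {c \<in> {1..<len j + 1}. Z j c = i}"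
  proof (intro Collect_cong iffI conjI)
    fix c assume "Z j c = i"
    with assms have "(j, c) \<in> skew_shape n len (\<lambda>_. 0)"
      unfolding tableaux_def by (metis (mono_tags, lifting) mem_Collect_eq not_one_le_zero)
    then show "c \<in> {1..<len j + 1}" by (simp add: skew_shape_def)
  qed auto
  then show ?thesis by (simp only: entry_count_def count_list_map_upt)
qed

lemma map_companion:
  assumes "j \<in> {1..n}"
  shows "map (companion n Y j) [1..<(\<Sum>i=1..n. entry_count Y j i) + 1] = companion_row n Y j"
  using assms by (intro nth_equalityI) (auto simp: companion_def length_companion_row simp del: upt_Suc)

text \<open>
  \<^term>\<open>companion n Y\<close> is the only non-skew tableau with rows \<open>1, \<dots>, n\<close> of the required
  lengths that are weakly increasing and satisfy \<open>a\<^sub>i\<^sub>,\<^sub>j(Y\<^sup>c) = a\<^sub>j\<^sub>,\<^sub>i(Y)\<close>.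
\<close>

lemma eq_companion_iff:
  fixes Y :: tableau and n :: nat
  defines "len \<equiv> \<lambda>j. \<Sum>i=1..n. entry_count Y j i"
  shows "Z = companion n Y \<longleftrightarrow>
    Z \<in> tableaux n len (\<lambda>_. 0) \<and> rows_weakly_increasing n len (\<lambda>_. 0) Z
      \<and> (\<forall>i\<in>{1..n}. \<forall>j\<in>{1..n}. entry_count Z i j = entry_count Y j i)"
    (is "_ \<longleftrightarrow> ?R Z")
proof -
  let ?C = "companion n Y"
  have pos: "x \<ge> 1" if "x \<in> set (companion_row n Y j)" for x j
    using that by (auto simp: companion_row_def)
  have tab: "?C \<in> tableaux n len (\<lambda>_. 0)"
    by (auto simp: tableaux_def skew_shape_def companion_def length_companion_row len_def
        intro!: pos[simplified] nth_mem)
  have rows: "rows_weakly_increasing n len (\<lambda>_. 0) ?C"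
    unfolding rows_weakly_increasing_def
    by (auto simp: skew_shape_def companion_def length_companion_row len_def
        intro!: sorted_nth_mono sorted_companion_row)
  have cnt: "entry_count ?C i j = entry_count Y j i" if "i \<in> {1..n}" "j \<in> {1..n}" for i j
    using that entry_count_tableau[OF tab that(2), of i] map_companion[OF that(2), of Y]
    by (simp add: len_def count_list_companion_row)
  have uniq: "Z = ?C" if Z: "?R Z" for Z
  proof (intro ext)
    fix j c
    show "Z j c = ?C j c"
    proof (cases "j \<in> {1..n} \<and> c \<in> {1..len j}")
      case False
      then show ?thesis using Z tab
        by (auto simp: tableaux_def skew_shape_def split: if_splits)
    next
      case True
      let ?zs = "map (Z j) [1..<len j + 1]"
      have "count_list ?zs i = count_list (companion_row n Y j) i" if "i \<in> {1..n}" for i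
        using Z True that entry_count_tableau[of Z n len j i]
        by (auto simp: count_list_companion_row)
      then have le: "count (mset (companion_row n Y j)) i \<le> count (mset ?zs) i" for i
        by (cases "i \<in> {1..n}") (simp_all only: count_mset count_list_companion_row if_False le_refl le0)
      then have sub: "mset (companion_row n Y j) \<subseteq># mset ?zs"
        by (simp add: subseteq_mset_def)
      have "size (mset (companion_row n Y j)) = size (mset ?zs)"
        by (simp only: size_mset length_map length_upt length_companion_row len_def add_diff_cancel_right')
      with sub have eq: "mset (companion_row n Y j) = mset ?zs"
        by (metis mset_subset_size nless_le subset_mset.le_imp_less_or_eq)
      have "sorted ?zs"
        using Z True
        by (auto simp: rows_weakly_increasing_def skew_shape_def sorted_iff_nth_mono simp del: upt_Suc)
      with eq have zs: "?zs = companion_row n Y j"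
        by (metis properties_for_sort sorted_companion_row)
      have "Z j c = ?zs ! (c - 1)" using True by (subst nth_map) (auto simp del: upt_Suc)
      also have "\<dots> = ?C j c"
        using True zs by (simp add: companion_def length_companion_row len_def del: upt_Suc)
      finally show ?thesis .
    qed
  qed
  show ?thesis using tab rows cnt uniq by blast
qed

end

theory Submission
  imports Defs
begin

text \<open>
  A tableau with weakly increasing rows is determined by its numbers \<open>a\<^sub>k\<^sub>,\<^sub>r\<close> of entries \<open>k\<close>
  in row \<open>r\<close>.  In terms of these numbers, column strictness says that the entries at most
  \<open>j\<close> of row \<open>i + 1\<close> end no further to the right than the entries less than \<open>j\<close> of row \<open>i\<close>;
  this is the bound on the exponent \<open>\<epsilon>\<^sup>(\<^sup>i\<^sup>)\<^sub>j\<close>.  The Yamanouchi property says that rows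
  \<open>1, \<dots>, i + 1\<close> contain at most as many entries \<open>j + 1\<close> as rows \<open>1, \<dots>, i\<close> contain entries
  \<open>j\<close>; it forces \<open>a\<^sub>k\<^sub>,\<^sub>r = 0\<close> for \<open>k > r\<close>, and for \<open>j \<le> i\<close> it is the second
  interlacing inequality of a GT pattern.
\<close>

section \<open>Partial sums of the entry counts, along letters and along rows\<close>

text \<open>With weakly increasing rows, \<open>mu r + row_count Y r j\<close> is the last column of
  row \<open>r\<close> in the shape formed by \<open>mu\<close> and the entries at most
  \<open>j\<close>.\<close>

definition row_count :: "tableau \<Rightarrow> nat \<Rightarrow> nat \<Rightarrow> nat" where
  "row_count Y r j = (\<Sum>h=1..j. entry_count Y h r)"

text \<open>Inside the triangle this is the array entry \<open>\<psi> n Y i k\<close>.\<close>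

definition upper_count :: "tableau \<Rightarrow> nat \<Rightarrow> nat \<Rightarrow> nat" where
  "upper_count Y k i = (\<Sum>r=1..i. entry_count Y k r)"

lemma row_count_0 [simp]: "row_count Y r 0 = 0"
  by (simp add: row_count_def)

lemma row_count_Suc: "row_count Y r (Suc j) = row_count Y r j + entry_count Y (Suc j) r"
  by (simp add: row_count_def)

lemma upper_count_0 [simp]: "upper_count Y k 0 = 0"
  by (simp add: upper_count_def)

lemma upper_count_Suc: "upper_count Y k (Suc i) = upper_count Y k i + entry_count Y k (Suc i)"
  by (simp add: upper_count_def)

lemma tableau_pos_iff:
  "Y \<in> tableaux n lam mu \<Longrightarrow> 0 < Y r c \<longleftrightarrow> (r, c) \<in> skew_shape n lam mu"
  unfolding tableaux_def by (auto split: if_splits dest: spec2[of _ r c])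

lemma tableau_row_eq:
  assumes "Y \<in> tableaux n lam mu" "r \<in> {1..n}" "1 \<le> k"
  shows "{c. Y r c = k} = {c \<in> {mu r + 1..<lam r + 1}. Y r c = k}"
  using tableau_pos_iff[OF assms(1), of r] assms(2,3)
  by (auto simp: skew_shape_def Suc_le_eq less_Suc_eq_le)

lemma entry_count_eq_count_list:
  assumes "Y \<in> tableaux n lam mu" "r \<in> {1..n}" "1 \<le> k"
  shows "entry_count Y k r = count_list (map (Y r) [mu r + 1..<lam r + 1]) k"
  unfolding entry_count_def count_list_map_upt tableau_row_eq[OF assms] ..

lemma row_count_eq_card:
  assumes Y: "Y \<in> tableaux n lam mu" and r: "r \<in> {1..n}"
  shows "row_count Y r j = card {c \<in> {mu r + 1..lam r}. Y r c \<le> j}"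
proof (induction j)
  case 0
  have "{c \<in> {mu r + 1..lam r}. Y r c \<le> 0} = {}"
    using tableau_pos_iff[OF Y, of r] r by (auto simp: skew_shape_def)
  then show ?case by (simp only: row_count_0 card.empty)
next
  case (Suc j)
  have "{c \<in> {mu r + 1..lam r}. Y r c \<le> Suc j}
      = {c \<in> {mu r + 1..lam r}. Y r c \<le> j} \<union> {c \<in> {mu r + 1..<lam r + 1}. Y r c = Suc j}"
    by auto
  then have "card {c \<in> {mu r + 1..lam r}. Y r c \<le> Suc j}
      = card {c \<in> {mu r + 1..lam r}. Y r c \<le> j} + card {c \<in> {mu r + 1..<lam r + 1}. Y r c = Suc j}"
    by (simp only:) (rule card_Un_disjoint; auto)
  then show ?case
    using tableau_row_eq[OF Y r, of "Suc j"] Suc by (simp add: row_count_Suc entry_count_def)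
qed

text \<open>Downward closedness fills \<open>D\<close> up to its maximum, so the cardinality fixes
  the right end. This turns counts into columns.\<close>

lemma initial_segment_eq:
  fixes D :: "nat set"
  assumes "D \<subseteq> {m + 1..l}" and closed: "\<And>c c'. c \<in> D \<Longrightarrow> m < c' \<Longrightarrow> c' \<le> c \<Longrightarrow> c' \<in> D"
  shows "D = {m + 1..m + card D}"
proof (cases "D = {}")
  case False
  have fin: "finite D" using assms(1) finite_subset by blast
  have "D = {m + 1..Max D}"
  proof
    show "D \<subseteq> {m + 1..Max D}" using assms(1) fin by auto
    show "{m + 1..Max D} \<subseteq> D" using closed[OF Max_in[OF fin False]] by auto
  qed
  moreover have "m < Max D" using Max_in[OF fin False] assms(1) by auto
  moreover have "card {m + 1..Max D} = Max D - m" by simp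
  ultimately show ?thesis by (metis add_diff_inverse_nat less_imp_not_less)
qed simp

text \<open>Since the row increases, its entries at most \<open>j\<close> occupy an initial segment,
  and \<open>row_count\<close> is the length of that segment.\<close>

lemma entry_le_iff:
  assumes Y: "Y \<in> tableaux n lam mu" and rows: "rows_weakly_increasing n lam mu Y"
    and rc: "(r, c) \<in> skew_shape n lam mu"
  shows "Y r c \<le> j \<longleftrightarrow> c \<le> mu r + row_count Y r j"
proof -
  let ?D = "{c \<in> {mu r + 1..lam r}. Y r c \<le> j}"
  have r: "r \<in> {1..n}" using rc by (simp add: skew_shape_def)
  have "?D = {mu r + 1..mu r + card ?D}"
  proof (rule initial_segment_eq)
    fix c c' assume c: "c \<in> ?D" and c': "mu r < c'" "c' \<le> c"
    then have "Y r c' \<le> Y r c"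
      using rows r by (auto simp: rows_weakly_increasing_def skew_shape_def)
    then show "c' \<in> ?D" using c c' by auto
  qed auto
  then have "c \<in> ?D \<longleftrightarrow> c \<in> {mu r + 1..mu r + card ?D}" by blast
  then show ?thesis using rc by (simp add: row_count_eq_card[OF Y r] skew_shape_def)
qed

lemma row_count_le:
  assumes "Y \<in> tableaux n lam mu" "r \<in> {1..n}"
  shows "row_count Y r j \<le> lam r - mu r"
proof -
  have "card {c \<in> {mu r + 1..lam r}. Y r c \<le> j} \<le> card {mu r + 1..lam r}"
    by (rule card_mono) auto
  then show ?thesis by (simp add: row_count_eq_card[OF assms])
qed

lemma row_count_stable:
  assumes "\<And>k. i < k \<Longrightarrow> entry_count Y k r = 0" "i \<le> j"
  shows "row_count Y r j = row_count Y r i"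
  using assms(2) by (induction j rule: dec_induct) (simp_all add: row_count_Suc assms(1))

lemma row_count_full:
  assumes Y: "Y \<in> tableaux n lam mu" and r: "r \<in> {1..n}"
    and supp: "\<And>k. r < k \<Longrightarrow> entry_count Y k r = 0" and "r \<le> j"
  shows "row_count Y r j = lam r - mu r"
proof -
  \<comment> \<open>An infinite set also has \<open>card\<close> 0, so \<open>entry_count\<close> 0
    excludes an entry only together with finiteness.\<close>
  have fin: "finite {c. Y r c = k}" if "1 \<le> k" for k
    using tableau_row_eq[OF Y r that] by simp
  have "Y r c \<le> r" for c
  proof (rule ccontr)
    assume "\<not> Y r c \<le> r"
    then have "card {c'. Y r c' = Y r c} = 0" "finite {c'. Y r c' = Y r c}"
      using supp[of "Y r c"] fin[of "Y r c"] by (auto simp: entry_count_def)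
    then show False by auto
  qed
  then have "{c \<in> {mu r + 1..lam r}. Y r c \<le> r} = {mu r + 1..lam r}" by auto
  then have "row_count Y r r = card {mu r + 1..lam r}" by (simp only: row_count_eq_card[OF Y r])
  then show ?thesis using row_count_stable[of r Y r j] supp \<open>r \<le> j\<close> by simp
qed

section \<open>Column strictness in terms of counts\<close>

lemma polynomial_dominant_weightD:
  "polynomial_dominant_weight n lam \<Longrightarrow> 1 \<le> i \<Longrightarrow> i \<le> j \<Longrightarrow> j \<le> n \<Longrightarrow> lam j \<le> lam i"
  by (auto simp: polynomial_dominant_weight_def monotone_on_def)

lemma columns_strictly_increasing_iff:
  assumes lam: "polynomial_dominant_weight n lam" and mu: "polynomial_dominant_weight n mu"
    and Y: "Y \<in> tableaux n lam mu" and rows: "rows_weakly_increasing n lam mu Y"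
    and sub: "\<forall>i\<in>{1..n}. mu i \<le> lam i"
  shows "columns_strictly_increasing n lam mu Y \<longleftrightarrow>
    (\<forall>i j. 1 \<le> i \<and> i < n \<longrightarrow>
       mu (Suc i) + row_count Y (Suc i) (Suc j) \<le> mu i + row_count Y i j)"
    (is "_ \<longleftrightarrow> ?R")
proof
  assume cols: "columns_strictly_increasing n lam mu Y"
  show ?R
  proof (intro allI impI)
    fix i j assume i: "1 \<le> i \<and> i < n"
    \<comment> \<open>If row \<open>Suc i\<close> has entries at most \<open>Suc j\<close>, the last
      of them is in column \<open>?c\<close>. Beyond \<open>mu i\<close> there is a box above it,
      since \<open>lam\<close> decreases.\<close>
    let ?c = "mu (Suc i) + row_count Y (Suc i) (Suc j)"
    show "?c \<le> mu i + row_count Y i j"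
    proof (cases "?c \<le> mu i")
      case False
      have mm: "mu (Suc i) \<le> mu i" and ll: "lam (Suc i) \<le> lam i"
        using i polynomial_dominant_weightD[OF mu, of i "Suc i"]
          polynomial_dominant_weightD[OF lam, of i "Suc i"] by auto
      have "?c \<le> lam (Suc i)"
        using row_count_le[OF Y, of "Suc i" "Suc j"] i sub[rule_format, of "Suc i"] by auto
      then have below: "(Suc i, ?c) \<in> skew_shape n lam mu" and above: "(i, ?c) \<in> skew_shape n lam mu"
        using i mm ll False by (auto simp: skew_shape_def)
      have "Y (Suc i) ?c \<le> Suc j" using entry_le_iff[OF Y rows below] by simp
      moreover have "Y i ?c < Y (Suc i) ?c"
        using cols above below unfolding columns_strictly_increasing_def by blast
      ultimately show ?thesis using entry_le_iff[OF Y rows above, of j] by simp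
    qed simp
  qed
next
  assume R: ?R
  \<comment> \<open>In adjacent rows, the bound for \<open>j = Y (Suc i) c - 1\<close> forces the
    upper entry to be at most \<open>j\<close>.\<close>
  have adj: "Y i c < Y (Suc i) c"
    if below: "(Suc i, c) \<in> skew_shape n lam mu" and above: "(i, c) \<in> skew_shape n lam mu" for i c
  proof -
    obtain j where j: "Y (Suc i) c = Suc j"
      using tableau_pos_iff[OF Y, of "Suc i" c] below by (cases "Y (Suc i) c") auto
    have "c \<le> mu (Suc i) + row_count Y (Suc i) (Suc j)"
      using entry_le_iff[OF Y rows below, of "Suc j"] j by simp
    also have "\<dots> \<le> mu i + row_count Y i j" using R above below by (auto simp: skew_shape_def)
    finally show ?thesis using entry_le_iff[OF Y rows above, of j] j by simp
  qed
  have "Y r c < Y r' c"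
    if "r < r'" "(r, c) \<in> skew_shape n lam mu" "(r', c) \<in> skew_shape n lam mu" for r r' c
    using that(1,3)
  proof (induction r')
    case (Suc s)
    show ?case
    proof (cases "r = s")
      case True
      then show ?thesis using adj Suc.prems that(2) by blast
    next
      case False
      then have "r < s" using Suc.prems by simp
      \<comment> \<open>Columns of the skew shape have no gaps:
        \<open>mu s <= mu r < c <= lam (Suc s) <= lam s\<close>.\<close>
      moreover from this have s: "(s, c) \<in> skew_shape n lam mu"
        using that(2) Suc.prems polynomial_dominant_weightD[OF mu, of r s]
          polynomial_dominant_weightD[OF lam, of s "Suc s"]
        by (auto simp: skew_shape_def)
      ultimately show ?thesis using Suc.IH adj[OF Suc.prems(2) s] by linarith
    qed
  qed simp
  then show "columns_strictly_increasing n lam mu Y"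
    unfolding columns_strictly_increasing_def by blast
qed


section \<open>The Yamanouchi property in terms of counts\<close>

lemma take_concat:
  assumes "xss \<noteq> []"
  shows "\<exists>i<length xss. \<exists>k. take m (concat xss) = concat (take i xss) @ take k (xss ! i)"
  using assms
proof (induction xss arbitrary: m)
  case (Cons xs xss)
  show ?case
  proof (cases "m \<le> length xs \<or> xss = []")
    case True
    then show ?thesis by (intro exI[of _ 0] conjI exI[of _ m]) auto
  next
    case False
    then obtain i k where "i < length xss"
      and "take (m - length xs) (concat xss) = concat (take i xss) @ take k (xss ! i)"
      using Cons.IH by blast
    then show ?thesis using False by (intro exI[of _ "Suc i"] conjI exI[of _ k]) auto
  qed
qed simp

lemma count_list_take_le: "count_list (take k xs) x \<le> count_list xs x"
  by (metis append_take_drop_id count_list_append le_add1)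

text \<open>In a weakly decreasing list all letters greater than \<open>a\<close> come first, so the
  prefix misses no \<open>Suc a\<close>.\<close>

lemma count_list_takeWhile_greater:
  fixes xs :: "nat list"
  assumes "sorted (rev xs)"
  shows "count_list (takeWhile (\<lambda>x. a < x) xs) (Suc a) = count_list xs (Suc a)"
  using assms
proof (induction xs)
  case (Cons x xs)
  show ?case
  proof (cases "a < x")
    case False
    then have "Suc a \<notin> set (x # xs)" using Cons.prems by (auto simp: sorted_append)
    then show ?thesis using False by (simp add: count_notin del: count_list.simps)
  qed (use Cons in \<open>auto simp: sorted_append\<close>)
qed simp

definition rev_row :: "(nat \<Rightarrow> nat) \<Rightarrow> (nat \<Rightarrow> nat) \<Rightarrow> tableau \<Rightarrow> nat \<Rightarrow> nat list" where
  "rev_row lam mu Y r = rev (map (Y r) [mu r + 1..<lam r + 1])"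

lemma rev_reading_word:
  "rev (reading_word n lam mu Y) = concat (map (rev_row lam mu Y) [1..<n + 1])"
  by (simp add: reading_word_def rev_row_def[abs_def] rev_concat rev_map comp_def del: upt_Suc)

lemma count_list_rev_row:
  assumes "Y \<in> tableaux n lam mu" "r \<in> {1..n}" "1 \<le> k"
  shows "count_list (rev_row lam mu Y r) k = entry_count Y k r"
  using entry_count_eq_count_list[OF assms] by (simp add: rev_row_def del: upt_Suc)

lemma count_list_rev_rows:
  assumes Y: "Y \<in> tableaux n lam mu" and k: "1 \<le> k" and "i \<le> n"
  shows "count_list (concat (map (rev_row lam mu Y) [1..<i + 1])) k = upper_count Y k i"
  using \<open>i \<le> n\<close>
  by (induction i) (simp_all add: upper_count_Suc count_list_rev_row[OF Y _ k])

lemma sorted_rev_rev_row: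
  assumes "rows_weakly_increasing n lam mu Y" "r \<in> {1..n}"
  shows "sorted (rev (rev_row lam mu Y r))"
proof -
  have "Y r c \<le> Y r c'" if "c \<in> {mu r + 1..lam r}" "c' \<in> {mu r + 1..lam r}" "c \<le> c'" for c c'
    using assms that unfolding rows_weakly_increasing_def skew_shape_def by blast
  then show ?thesis by (auto simp: rev_row_def sorted_iff_nth_mono simp del: upt_Suc)
qed

text \<open>
  The worst initial segment for the letters \<open>a\<close>, \<open>a + 1\<close> consists of some full rows and the
  part of the next row with entries greater than \<open>a\<close>.
\<close>

lemma yamanouchi_iff:
  assumes Y: "Y \<in> tableaux n lam mu" and rows: "rows_weakly_increasing n lam mu Y"
  shows "yamanouchi (rev (reading_word n lam mu Y)) \<longleftrightarrow>
    (\<forall>i a. i < n \<and> 1 \<le> a \<longrightarrow> upper_count Y (Suc a) (Suc i) \<le> upper_count Y a i)"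
    (is "?L \<longleftrightarrow> ?R")
proof
  let ?row = "rev_row lam mu Y"
  let ?W = "\<lambda>i. concat (map ?row [1..<i + 1])"
  show ?R if L: ?L
  proof (intro allI impI)
    fix i a :: nat assume i: "i < n \<and> 1 \<le> a"
    let ?v = "takeWhile (\<lambda>x. a < x) (?row (Suc i))"
    have "[1..<n + 1] = [1..<i + 1] @ Suc i # [i + 2..<n + 1]"
      using i upt_add_eq_append[of 1 "i + 1" "n - i"] by (simp add: upt_conv_Cons del: upt_Suc)
    then have "?W n = (?W i @ ?v) @ dropWhile (\<lambda>x. a < x) (?row (Suc i)) @ concat (map ?row [i + 2..<n + 1])"
      by (simp del: upt_Suc)
    then have "take (length (?W i @ ?v)) (?W n) = ?W i @ ?v" by (metis append_eq_conv_conj)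
    then have "count_list (?W i @ ?v) (a + 1) \<le> count_list (?W i @ ?v) a"
      using L i unfolding yamanouchi_def rev_reading_word by metis
    moreover have "count_list ?v a = 0" by (auto simp: count_list_0_iff dest: set_takeWhileD)
    moreover have "count_list ?v (Suc a) = entry_count Y (Suc a) (Suc i)"
      using count_list_takeWhile_greater[OF sorted_rev_rev_row[OF rows, of "Suc i"], of a]
        count_list_rev_row[OF Y, of "Suc i" "Suc a"] i by simp
    ultimately show "upper_count Y (Suc a) (Suc i) \<le> upper_count Y a i"
      using count_list_rev_rows[OF Y, of _ i] i by (simp add: upper_count_Suc del: upt_Suc)
  qed
  show ?L if R: ?R
    unfolding yamanouchi_def rev_reading_word
  proof (intro allI impI)
    fix m a :: nat assume a: "1 \<le> a"
    show "count_list (take m (?W n)) (a + 1) \<le> count_list (take m (?W n)) a"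
    proof (cases "n = 0")
      case False
      then obtain i k where i: "i < n"
        and eq: "take m (?W n) = concat (take i (map ?row [1..<n + 1])) @ take k (map ?row [1..<n + 1] ! i)"
        using take_concat[of "map ?row [1..<n + 1]" m] by (auto simp del: upt_Suc)
      \<comment> \<open>The list of rows starts at index 0, so index \<open>i\<close> holds row
        \<open>Suc i\<close>.\<close>
      have eq: "take m (?W n) = ?W i @ take k (?row (Suc i))"
        using i unfolding eq take_map by (simp add: take_upt del: upt_Suc)
      \<comment> \<open>For an upper bound on \<open>a + 1\<close> the partial row is completed; for
        a lower bound on \<open>a\<close> it is dropped.\<close>
      have "count_list (take m (?W n)) (a + 1) \<le> upper_count Y (a + 1) i + entry_count Y (a + 1) (Suc i)"
        using count_list_take_le[of k "?row (Suc i)" "a + 1"] i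
          count_list_rev_rows[OF Y, of "a + 1" i] count_list_rev_row[OF Y, of "Suc i" "a + 1"]
        unfolding eq by (simp del: upt_Suc)
      also have "\<dots> \<le> upper_count Y a i" using R i a by (simp add: upper_count_Suc)
      also have "\<dots> \<le> count_list (take m (?W n)) a"
        using count_list_rev_rows[OF Y a, of i] i unfolding eq by (simp del: upt_Suc)
      finally show ?thesis .
    qed simp
  qed
qed

section \<open>Content, and entries bounded by their row\<close>

text \<open>With \<open>i = n\<close> this gives the content, with arbitrary \<open>i\<close> the
  direct description of the array.\<close>

lemma card_entries_in_rows:
  assumes Y: "Y \<in> tableaux n lam mu" and k: "1 \<le> k" and "i \<le> n"
  shows "card {(r, c) \<in> skew_shape n lam mu. r \<in> {1..i} \<and> Y r c = k} = upper_count Y k i"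
proof -
  have "{(r, c) \<in> skew_shape n lam mu. r \<in> {1..i} \<and> Y r c = k} = Sigma {1..i} (\<lambda>r. {c. Y r c = k})"
    using tableau_pos_iff[OF Y] k by fastforce
  moreover have "finite {c. Y r c = k}" if "r \<in> {1..i}" for r
    using tableau_row_eq[OF Y _ k, of r] that \<open>i \<le> n\<close> by simp
  ultimately show ?thesis by (simp add: upper_count_def entry_count_def)
qed

lemma has_content_iff:
  assumes "Y \<in> tableaux n lam mu"
  shows "has_content n lam mu nu Y \<longleftrightarrow> (\<forall>k\<ge>1. upper_count Y k n = (if k \<le> n then nu k else 0))"
proof -
  have "{(r, c) \<in> skew_shape n lam mu. Y r c = k}
      = {(r, c) \<in> skew_shape n lam mu. r \<in> {1..n} \<and> Y r c = k}" for k
    by (auto simp: skew_shape_def)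
  then show ?thesis
    using card_entries_in_rows[OF assms, of _ n] by (simp add: has_content_def del: atLeastAtMost_iff)
qed

text \<open>Each Yamanouchi inequality lowers letter and row by one, so a letter beyond its row
  index descends to the empty set of rows.\<close>

lemma upper_count_eq_0:
  assumes "\<And>i a. i < n \<Longrightarrow> 1 \<le> a \<Longrightarrow> upper_count Y (Suc a) (Suc i) \<le> upper_count Y a i"
    and "i \<le> n" "i < k"
  shows "upper_count Y k i = 0"
  using assms(2,3)
proof (induction i arbitrary: k)
  case (Suc i)
  then obtain k' where "k = Suc k'" "1 \<le> k'" "i < k'" by (cases k) auto
  then show ?case using assms(1)[of i k'] Suc by simp
qed simp

lemma yamanouchi_imp_entry_le_row:
  assumes "\<And>i a. i < n \<Longrightarrow> 1 \<le> a \<Longrightarrow> upper_count Y (Suc a) (Suc i) \<le> upper_count Y a i"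
    and "r \<in> {1..n}" "r < k"
  shows "entry_count Y k r = 0"
proof -
  have "upper_count Y k r = 0" using assms by (intro upper_count_eq_0[of n]) auto
  then show ?thesis using assms(2) by (cases r) (simp_all add: upper_count_Suc)
qed

section \<open>The array of the companion tableau\<close>

text \<open>Passing to the companion swaps letter and row, so summing over its rows \<open>1\<close>
  to \<open>i\<close> counts \<open>j\<close> in the first \<open>i\<close> rows of
  \<open>Y\<close>.\<close>

lemma \<psi>_eq:
  "\<psi> n Y i j = (if 1 \<le> j \<and> j \<le> i \<and> i \<le> n then int (upper_count Y j i) else 0)"
  using eq_companion_iff[of "companion n Y" n Y]
  by (auto simp: \<psi>_def array_of_tableau_def upper_count_def intro!: sum.cong)

text \<open>The second difference of the array in the row direction is the difference of the counts
  in rows \<open>Suc i\<close> and \<open>i\<close>; summation over letters gives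
  \<open>row_count\<close>.\<close>

lemma exponent_\<psi>:
  assumes "1 \<le> j" "j \<le> i" "i < n"
  shows "exponent (\<psi> n Y) i j = int (row_count Y (Suc i) j) - int (row_count Y i (j - 1))"
proof -
  obtain i' where i': "i = Suc i'" using assms by (cases i) auto
  \<comment> \<open>Here \<open>h < j <= i\<close>, so \<open>h <= i - 1\<close> and no default
    value outside the triangle enters.\<close>
  have "\<psi> n Y (i + 1) h - 2 * \<psi> n Y i h + \<psi> n Y (i - 1) h
      = int (entry_count Y h (Suc i)) - int (entry_count Y h i)" if "h \<in> {1..<j}" for h
    using that assms by (auto simp: \<psi>_eq upper_count_Suc i')
  then have "(\<Sum>h=1..<j. \<psi> n Y (i + 1) h - 2 * \<psi> n Y i h + \<psi> n Y (i - 1) h)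
      = (\<Sum>h=1..<j. int (entry_count Y h (Suc i))) - (\<Sum>h=1..<j. int (entry_count Y h i))"
    unfolding sum_subtractf[symmetric] by (intro sum.cong refl)
  moreover have "\<psi> n Y (i + 1) j - \<psi> n Y i j = int (entry_count Y j (Suc i))"
    using assms by (simp add: \<psi>_eq upper_count_Suc)
  ultimately have "exponent (\<psi> n Y) i j = (\<Sum>h=1..<j. int (entry_count Y h (Suc i)))
      - (\<Sum>h=1..<j. int (entry_count Y h i)) + int (entry_count Y j (Suc i))"
    by (simp only: exponent_def)
  also have "{1..<j} = {1..j - 1}" using assms by auto
  also have "(\<Sum>h=1..j - 1. int (entry_count Y h (Suc i))) = int (row_count Y (Suc i) (j - 1))"
    by (simp add: row_count_def)
  also have "(\<Sum>h=1..j - 1. int (entry_count Y h i)) = int (row_count Y i (j - 1))"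
    by (simp add: row_count_def)
  finally show ?thesis using row_count_Suc[of Y "Suc i" "j - 1"] assms by simp
qed

lemma weight_\<psi>:
  assumes supp: "\<And>r k. r \<in> {1..n} \<Longrightarrow> r < k \<Longrightarrow> entry_count Y k r = 0" and "1 \<le> i" "i \<le> n"
  shows "weight (\<psi> n Y) i = int (row_count Y i i)"
proof -
  obtain i' where i': "i = Suc i'" using assms by (cases i) auto
  \<comment> \<open>This vanishing term lets both sums run up to \<open>i\<close>.\<close>
  have upper: "upper_count Y i i' = 0" using assms i' by (auto simp: upper_count_def)
  have "weight (\<psi> n Y) i = (\<Sum>k=1..i. \<psi> n Y i k) - (\<Sum>k=1..i'. \<psi> n Y i' k)"
    by (simp add: weight_def i')
  also have "\<dots> = (\<Sum>k=1..i. int (upper_count Y k i)) - (\<Sum>k=1..i'. int (upper_count Y k i'))"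
    using assms i' by (intro arg_cong2[of _ _ _ _ minus] sum.cong) (auto simp: \<psi>_eq)
  also have "\<dots> = (\<Sum>k=1..i. int (upper_count Y k i)) - (\<Sum>k=1..i. int (upper_count Y k i'))"
    using upper by (simp add: i')
  also have "\<dots> = int (row_count Y i i)"
    by (simp add: i' upper_count_Suc row_count_def sum.distrib)
  finally show ?thesis .
qed

text \<open>
  The three conditions express, in this order, strictly increasing columns, the Yamanouchi
  property and the content.
\<close>

definition count_conditions :: "nat \<Rightarrow> (nat \<Rightarrow> nat) \<Rightarrow> (nat \<Rightarrow> nat) \<Rightarrow> tableau \<Rightarrow> bool" where
  "count_conditions n mu nu Y \<longleftrightarrow>
    (\<forall>i j. 1 \<le> i \<and> i < n \<longrightarrow>
       mu (Suc i) + row_count Y (Suc i) (Suc j) \<le> mu i + row_count Y i j)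
    \<and> (\<forall>i a. i < n \<and> 1 \<le> a \<longrightarrow> upper_count Y (Suc a) (Suc i) \<le> upper_count Y a i)
    \<and> (\<forall>k\<ge>1. upper_count Y k n = (if k \<le> n then nu k else 0))"

lemma LR_iff:
  assumes "polynomial_dominant_weight n lam" "polynomial_dominant_weight n mu"
    and "\<forall>i\<in>{1..n}. mu i \<le> lam i"
  shows "Y \<in> LR n lam mu nu \<longleftrightarrow>
    Y \<in> tableaux n lam mu \<and> rows_weakly_increasing n lam mu Y \<and> count_conditions n mu nu Y"
proof (cases "Y \<in> tableaux n lam mu \<and> rows_weakly_increasing n lam mu Y")
  case True
  then show ?thesis
    using columns_strictly_increasing_iff[OF assms(1,2) _ _ assms(3)]
    by (auto simp: LR_def semistandard_def count_conditions_def yamanouchi_iff has_content_iff)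
qed (auto simp: LR_def semistandard_def)

text \<open>The inequalities in \<open>GZ\<close> concern only \<open>j <= i\<close>, those in
  \<open>count_conditions\<close> also larger letters; \<open>supp\<close> settles the rest. The
  weight is right because all \<open>lam i - mu i\<close> boxes of row \<open>i\<close> have entries
  at most \<open>i\<close>.\<close>

lemma \<psi>_in_GZ_iff:
  assumes lam: "polynomial_dominant_weight n lam"
    and sub: "\<forall>i\<in>{1..n}. mu i \<le> lam i"
    and Y: "Y \<in> tableaux n lam mu"
    and supp: "\<And>r k. r \<in> {1..n} \<Longrightarrow> r < k \<Longrightarrow> entry_count Y k r = 0"
  shows "\<psi> n Y \<in> GZ n (\<lambda>i. int (nu i)) (\<lambda>i. int (lam i) - int (mu i)) (\<lambda>i. int (mu i))
    \<longleftrightarrow> count_conditions n mu nu Y"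
proof -
  have upper0: "upper_count Y k i = 0" if "i \<le> n" "i < k" for i k
    using supp that by (auto simp: upper_count_def)
  have full: "row_count Y r j = lam r - mu r" if "r \<in> {1..n}" "r \<le> j" for r j
    using row_count_full[OF Y that(1) supp] that by blast
  have arr: "\<psi> n Y \<in> t_arrays n" by (auto simp: t_arrays_def \<psi>_eq)
  have wt: "weight (\<psi> n Y) i = int (lam i) - int (mu i)" if "i \<in> {1..n}" for i
    using weight_\<psi>[of n Y i] supp that full[of i i] sub by (simp add: of_nat_diff)
  have type: "has_type n (\<psi> n Y) (\<lambda>i. int (nu i)) \<longleftrightarrow>
      (\<forall>k\<ge>1. upper_count Y k n = (if k \<le> n then nu k else 0))"
    by (auto simp: has_type_def \<psi>_eq upper0)
  have GT: "GT_pattern n (\<psi> n Y) \<longleftrightarrow>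
      (\<forall>i a. i < n \<and> 1 \<le> a \<longrightarrow> upper_count Y (Suc a) (Suc i) \<le> upper_count Y a i)" (is "_ \<longleftrightarrow> ?C2")
  proof -
    have grow: "upper_count Y a i \<le> upper_count Y a (Suc i)" for a i
      by (simp add: upper_count_Suc)
    have "GT_pattern n (\<psi> n Y) \<longleftrightarrow>
      (\<forall>i a. 1 \<le> a \<and> a \<le> i \<and> i < n \<longrightarrow> upper_count Y (Suc a) (Suc i) \<le> upper_count Y a i)"
      using grow by (auto simp: GT_pattern_def \<psi>_eq)
    also have "\<dots> \<longleftrightarrow> ?C2" using upper0 by (metis Suc_leI not_less_eq not_le le0)
    finally show ?thesis .
  qed
  have "(\<forall>i j. 1 \<le> j \<and> j \<le> i \<and> i < n \<longrightarrow>
        exponent (\<psi> n Y) i j \<le> int (mu i) - int (mu (i + 1))) \<longleftrightarrow>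
      (\<forall>i j. 1 \<le> j \<and> j \<le> i \<and> i < n \<longrightarrow>
        mu (Suc i) + row_count Y (Suc i) j \<le> mu i + row_count Y i (j - 1))"
    by (intro all_cong1 imp_cong) (auto simp: exponent_\<psi> le_diff_eq diff_le_eq algebra_simps simp flip: of_nat_add)
  also have "\<dots> \<longleftrightarrow> (\<forall>i j. 1 \<le> i \<and> i < n \<longrightarrow>
        mu (Suc i) + row_count Y (Suc i) (Suc j) \<le> mu i + row_count Y i j)"
    (is "?E \<longleftrightarrow> ?C1")
  proof
    assume E: ?E
    show ?C1
    proof (intro allI impI)
      fix i j assume i: "1 \<le> i \<and> i < n"
      show "mu (Suc i) + row_count Y (Suc i) (Suc j) \<le> mu i + row_count Y i j"
      proof (cases "Suc j \<le> i")
        case True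
        then show ?thesis using E[rule_format, of "Suc j" i] i by simp
      next
        \<comment> \<open>Both rows are exhausted, and the claim reduces to
          \<open>lam (Suc i) <= lam i\<close>.\<close>
        case False
        then show ?thesis
          using full[of i j] full[of "Suc i" "Suc j"] sub[rule_format, of i]
            sub[rule_format, of "Suc i"] polynomial_dominant_weightD[OF lam, of i "Suc i"] i
          by simp
      qed
    qed
  next
    assume C1: ?C1
    show ?E
    proof (intro allI impI)
      fix i j assume "1 \<le> j \<and> j \<le> i \<and> i < n"
      then show "mu (Suc i) + row_count Y (Suc i) j \<le> mu i + row_count Y i (j - 1)"
        using C1[rule_format, of i "j - 1"] by simp
    qed
  qed
  finally show ?thesis
    using arr wt type GT by (auto simp: GZ_def count_conditions_def)
qed

section \<open>Tableaux with prescribed counts\<close>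

text \<open>Each row is filled with consecutive blocks of lengths \<open>a 1 r\<close>,
  \<open>a 2 r\<close>, and so on; this is the source of surjectivity.\<close>

lemma exists_tableau_with_counts:
  assumes total: "\<And>r. r \<in> {1..n} \<Longrightarrow> (\<Sum>k=1..r. a k r) = lam r - mu r"
    and supp: "\<And>r k. r < k \<Longrightarrow> a k r = 0"
  obtains Y where "Y \<in> tableaux n lam mu" "rows_weakly_increasing n lam mu Y"
    "\<And>r k. r \<in> {1..n} \<Longrightarrow> 1 \<le> k \<Longrightarrow> entry_count Y k r = a k r"
proof -
  define p where "p r j = (\<Sum>k=1..j. a k r)" for r j
  have mono: "p r j \<le> p r j'" if "j \<le> j'" for r j j'
    unfolding p_def using that by (intro sum_mono2) auto
  have bound: "p r j \<le> p r r" for r j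
  proof (cases "j \<le> r")
    case False
    then have "p r j = p r r" unfolding p_def using supp by (intro sum.mono_neutral_right) auto
    then show ?thesis by simp
  qed (rule mono)
  \<comment> \<open>Block \<open>j\<close> ends in column \<open>mu r + p r j\<close>, so the entry
    in column \<open>c\<close> is the first \<open>j\<close> whose block reaches
    \<open>c\<close>.\<close>
  define Y where "Y r c = (if (r, c) \<in> skew_shape n lam mu then LEAST j. c \<le> mu r + p r j else 0)" for r c
  have le_iff: "Y r c \<le> j \<longleftrightarrow> c \<le> mu r + p r j" if rc: "(r, c) \<in> skew_shape n lam mu" for r c j
  proof
    assume le: "Y r c \<le> j"
    have "c \<le> mu r + p r r" using rc total[of r] by (auto simp: skew_shape_def p_def)
    then have "c \<le> mu r + p r (LEAST j. c \<le> mu r + p r j)" by (rule LeastI)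
    also have "\<dots> \<le> mu r + p r j" using le rc mono by (simp add: Y_def)
    finally show "c \<le> mu r + p r j" .
  qed (use rc in \<open>auto simp: Y_def intro: Least_le\<close>)
  have pos: "0 < Y r c" if "(r, c) \<in> skew_shape n lam mu" for r c
    using le_iff[OF that, of 0] that by (auto simp: p_def skew_shape_def)
  have "entry_count Y k r = a k r" if r: "r \<in> {1..n}" and "1 \<le> k" for r k
  proof -
    obtain k' where k: "k = Suc k'" using \<open>1 \<le> k\<close> by (cases k) auto
    have "p r r = lam r - mu r" using total[OF r] by (simp add: p_def)
    \<comment> \<open>Subtraction is truncated: when \<open>lam r < mu r\<close> the row is empty
      and every \<open>p r k\<close> is 0.\<close>
    then have lam: "mu r + p r k \<le> lam r \<or> p r k = 0" using bound[of r k] by linarith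
    have "Y r c = k \<longleftrightarrow> c \<in> {mu r + p r k' + 1..mu r + p r k}" for c
    proof (cases "(r, c) \<in> skew_shape n lam mu")
      case True
      then show ?thesis using le_iff[OF True, of k] le_iff[OF True, of k'] by (auto simp: k)
    next
      case False
      then show ?thesis using r lam by (auto simp: Y_def k skew_shape_def)
    qed
    then have "{c. Y r c = k} = {mu r + p r k' + 1..mu r + p r k}" by blast
    then have "entry_count Y k r = p r k - p r k'" by (simp add: entry_count_def)
    also have "\<dots> = a k r" by (simp add: p_def k)
    finally show ?thesis .
  qed
  moreover have "Y \<in> tableaux n lam mu" using pos by (auto simp: tableaux_def Y_def Suc_le_eq)
  moreover have "rows_weakly_increasing n lam mu Y"
    unfolding rows_weakly_increasing_def using le_iff by (meson le_trans order_refl)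
  ultimately show thesis using that by blast
qed

section \<open>The bijection\<close>

theorem theorem5p3:
  fixes n :: nat and lam mu nu :: "nat \<Rightarrow> nat"
  assumes "1 \<le> n"
    and "polynomial_dominant_weight n lam"
    and "polynomial_dominant_weight n mu"
    and "polynomial_dominant_weight n nu"
    and "\<forall>i\<in>{1..n}. mu i \<le> lam i"
  shows "bij_betw (\<psi> n) (LR n lam mu nu)
           (GZ n (\<lambda>i. int (nu i)) (\<lambda>i. int (lam i) - int (mu i)) (\<lambda>i. int (mu i)))
       \<and> (\<forall>Y\<in>LR n lam mu nu. \<forall>i j. 1 \<le> j \<and> j \<le> i \<and> i \<le> n \<longrightarrow>
            \<psi> n Y i j = int (card {(r, c) \<in> skew_shape n lam mu. r \<in> {1..i} \<and> Y r c = j}))"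
    (is "bij_betw _ ?LR ?GZ \<and> ?formula")
proof -
  note LR_iff = LR_iff[OF assms(2,3,5)]
  have supp: "entry_count Y k r = 0" if "Y \<in> ?LR" "r \<in> {1..n}" "r < k" for Y r k
    using that by (intro yamanouchi_imp_entry_le_row[of n]) (auto simp: LR_iff count_conditions_def)
  have GZ: "\<psi> n Y \<in> ?GZ" if "Y \<in> ?LR" for Y
    using \<psi>_in_GZ_iff[OF assms(2,5), of Y nu] supp[OF that] that by (auto simp: LR_iff)
  \<comment> \<open>The hypotheses are symmetric in \<open>Y\<close> and \<open>Y'\<close>, so one
    inequality suffices; \<open>antisym\<close> later gives equality.\<close>
  have inj: "Y r c \<le> Y' r c"
    if Y: "Y \<in> ?LR" and Y': "Y' \<in> ?LR" and eq: "\<psi> n Y = \<psi> n Y'" for Y Y' r c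
  proof (cases "(r, c) \<in> skew_shape n lam mu")
    case True
    then have r: "r \<in> {1..n}" by (simp add: skew_shape_def)
    then obtain r' where r': "r = Suc r'" by (cases r) auto
    have "entry_count Y k r = entry_count Y' k r" if "1 \<le> k" for k
    proof (cases "k \<le> r")
      case True
      \<comment> \<open>The count in row \<open>r\<close> is the difference of
        \<open>upper_count\<close> at \<open>r\<close> and \<open>r'\<close>. If
        \<open>k > r'\<close>, the array holds only a default at \<open>r'\<close>, and both counts
        there vanish by \<open>supp\<close>.\<close>
      have upper: "upper_count Y k i = upper_count Y' k i" if "i \<in> {r', r}" for i
      proof (cases "k \<le> i")
        case True
        then show ?thesis using fun_cong[OF fun_cong[OF eq, of i], of k] \<open>1 \<le> k\<close> that r r'
          by (auto simp: \<psi>_eq)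
      next
        case False
        then show ?thesis unfolding upper_count_def
          using supp[OF Y] supp[OF Y'] that r r' by (intro sum.cong) auto
      qed
      show ?thesis using upper[of r] upper[of r'] by (simp add: r' upper_count_Suc)
    qed (use supp[OF Y r] supp[OF Y' r] in simp)
    then have "row_count Y r j = row_count Y' r j" for j by (simp add: row_count_def)
    then show ?thesis
      using entry_le_iff[OF _ _ True] Y Y' by (metis LR_iff order_refl)
  next
    case False
    then show ?thesis using tableau_pos_iff[of Y n lam mu r c] Y by (simp add: LR_iff)
  qed
  have surj: "T \<in> \<psi> n ` ?LR" if T: "T \<in> ?GZ" for T
  proof -
    have out: "T i j = 0" if "\<not> (1 \<le> j \<and> j \<le> i \<and> i \<le> n)" for i j
      using T that by (auto simp: GZ_def t_arrays_def)
    have up: "T i j \<le> T (Suc i) j" and down: "T (Suc i) (Suc j) \<le> T i j"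
      if "1 \<le> j" "j \<le> i" "i < n" for i j
      using T that by (auto simp: GZ_def GT_pattern_def)
    \<comment> \<open>The diagonal decreases down to \<open>T n n = nu n\<close>, which is
      nonnegative.\<close>
    have diag: "0 \<le> T i i" if "1 \<le> i" "i \<le> n" for i
      using that(2,1)
    proof (induction i rule: inc_induct)
      case base
      then show ?case using T by (auto simp: GZ_def has_type_def)
    next
      case (step i)
      then show ?case using down[of i i] by simp
    qed
    \<comment> \<open>Since \<open>upper_count\<close> must reproduce \<open>T\<close>, the counts
      are forced to be differences of consecutive rows of \<open>T\<close>.\<close>
    define a where "a k r = (if 1 \<le> k \<and> k \<le> r \<and> r \<le> n then nat (T r k - T (r - 1) k) else 0)" for k r
    \<comment> \<open>\<open>nat\<close> loses nothing: for \<open>k < r\<close> the difference is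
      nonnegative by interlacing, and for \<open>k = r\<close> the subtracted entry is a default
      0.\<close>
    have a: "int (a k r) = T r k - T (r - 1) k" if "1 \<le> k" "1 \<le> r" "r \<le> n" for k r
    proof -
      consider "k < r" | "k = r" | "r < k" by linarith
      then show ?thesis
      proof cases
        case 1
        then show ?thesis using up[of k "r - 1"] that by (simp add: a_def)
      next
        case 2
        then show ?thesis using diag[of r] out[of k "r - 1"] that by (simp add: a_def)
      next
        case 3
        then show ?thesis using out[of k r] out[of k "r - 1"] by (simp add: a_def)
      qed
    qed
    have total: "(\<Sum>k=1..r. a k r) = lam r - mu r" if r: "r \<in> {1..n}" for r
    proof -
      obtain r' where r': "r = Suc r'" using r by (cases r) auto
      have "int (\<Sum>k=1..r. a k r) = (\<Sum>k=1..r. T r k) - (\<Sum>k=1..r. T r' k)"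
        using a r r' by (simp add: sum_subtractf del: sum.cl_ivl_Suc)
      \<comment> \<open>The extra summand \<open>T r' r\<close> is outside the triangle, hence
        0.\<close>
      also have "\<dots> = weight T r" using out[of r r'] by (simp add: weight_def r')
      also have "\<dots> = int (lam r) - int (mu r)" using T r by (simp add: GZ_def)
      finally show ?thesis by linarith
    qed
    obtain Y where Y: "Y \<in> tableaux n lam mu" "rows_weakly_increasing n lam mu Y"
      and cnt: "\<And>r k. r \<in> {1..n} \<Longrightarrow> 1 \<le> k \<Longrightarrow> entry_count Y k r = a k r"
      using exists_tableau_with_counts[of n a lam mu] total by (auto simp: a_def)
    have upper: "int (upper_count Y j i) = T i j" if "i \<le> n" "1 \<le> j" for i j
      using that by (induction i) (simp_all add: upper_count_Suc cnt a out)
    have "\<psi> n Y = T"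
    proof (intro ext)
      fix i j show "\<psi> n Y i j = T i j" using upper[of i j] out[of j i] by (auto simp: \<psi>_eq)
    qed
    moreover have "entry_count Y k r = 0" if "r \<in> {1..n}" "r < k" for r k
      using that cnt[of r k] by (simp add: a_def)
    \<comment> \<open>Read from left to right, \<open>\<psi>_in_GZ_iff\<close> turns membership of
      \<open>T\<close> in \<open>GZ\<close> into the conditions on \<open>Y\<close>.\<close>
    ultimately have "Y \<in> ?LR"
      using \<psi>_in_GZ_iff[OF assms(2,5) Y(1), of nu] T Y by (simp add: LR_iff)
    then show ?thesis using \<open>\<psi> n Y = T\<close> by blast
  qed
  have "inj_on (\<psi> n) ?LR" using inj by (intro inj_onI ext) (simp add: antisym)
  then have "bij_betw (\<psi> n) ?LR ?GZ" using GZ surj by (auto simp: bij_betw_def)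
  moreover have ?formula
    using card_entries_in_rows by (auto simp: LR_iff \<psi>_eq simp del: atLeastAtMost_iff)
  ultimately show ?thesis by blast
qed

end
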